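(* Let $N\ge 1$ be an integer and let $p$ be a real number with $N<p<\infty$. Then for all $u\in C_{c,rad}^\infty(\mathbb{R}^N\setminus\{o\})$, $$\int_{\mathbb{R}^N}\max\left\{\sup_{y\in\bar B(o;|x|)\setminus\{o\}}\frac{|u(y)|^p}{|x|^p},\ \sup_{y\in B^c(o;|x|)}\frac{|u(y)|^p}{|y|^p}\right\}dx\le\left|\frac{p}{N-p}\right|^p\int_{\mathbb{R}^N}\left|\frac{x}{|x|}\cdot\nabla u(x)\right|^p dx .$$
   Context: $o$ denotes the origin of $\mathbb{R}^N$. $C_{c,rad}^\infty(\mathbb{R}^N\setminus\{o\})$ is the space of real-valued smooth functions with compact support contained in $\mathbb{R}^N\setminus\{o\}$ that are radial, i.e. $u(x)$ depends only on $|x|$. $B(o;r)=\{y\in\mathbb{R}^N:|y|<r\}$ is the open ball, $\bar B(o;r)=\{y:|y|\le r\}$ its closure, and $B^c(o;r)=\{y:|y|\ge r\}$ its complement. The dot is the Euclidean scalar product. *)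

theory Defs
  imports "HOL-Analysis.Analysis"
begin

(* f is of class C^k on the whole space: all iterated partial derivatives of order less than k
   are differentiable and those of order k are continuous. *)
primrec C_k :: "nat \<Rightarrow> ('a::euclidean_space \<Rightarrow> real) \<Rightarrow> bool" where
  "C_k 0 f \<longleftrightarrow> continuous_on UNIV f"
| "C_k (Suc k) f \<longleftrightarrow>
     f differentiable_on UNIV \<and> (\<forall>b\<in>Basis. C_k k (\<lambda>x. frechet_derivative f (at x) b))"

definition smooth :: "('a::euclidean_space \<Rightarrow> real) \<Rightarrow> bool" where
  "smooth f \<longleftrightarrow> (\<forall>k. C_k k f)"

definition supp :: "('a::euclidean_space \<Rightarrow> real) \<Rightarrow> 'a set" where
  "supp f = closure {x. f x \<noteq> 0}"

definition radial :: "('a::euclidean_space \<Rightarrow> real) \<Rightarrow> bool" where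
  "radial f \<longleftrightarrow> (\<forall>x y. norm x = norm y \<longrightarrow> f x = f y)"

(* Functions in this class vanish near the origin, so they are represented by their extension
   by zero to the whole space; smoothness of the extension is the same as smoothness off 0. *)
definition Cc_rad_smooth :: "('a::euclidean_space \<Rightarrow> real) set" where
  "Cc_rad_smooth = {u. smooth u \<and> compact (supp u) \<and> supp u \<subseteq> UNIV - {0} \<and> radial u}"

(* The gradient vector in the sense of the library's GDERIV; only meaningful where u is
   differentiable. *)
definition grad :: "('a::euclidean_space \<Rightarrow> real) \<Rightarrow> 'a \<Rightarrow> 'a" where
  "grad u x = (THE D. GDERIV u x :> D)"

end

theory Submission
  imports Defs
begin

text \<open>
  Write \<open>u x = f (norm x)\<close>, \<open>h = \<bar>f'\<bar>\<close>, \<open>g r\<close> for the integral of \<open>h\<close> over \<open>{0..r}\<close>, and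
  \<open>M r = (SUP s\<ge>r. g s / s)\<close>. Since \<open>\<bar>f\<bar> \<le> g\<close> and \<open>g\<close> increases, both suprema in the
  integrand are at most \<open>M (norm x) powr p\<close>. Let \<open>w r = r ^ (N - 1)\<close>. The set \<open>{M > t}\<close> is an
  interval from \<open>0\<close> to some \<open>R\<close> with \<open>g R \<ge> t * R\<close>, so integrating the derivative of \<open>g * w\<close>
  over it shows that \<open>(h + (N - 1) * M) * w\<close> has integral at least \<open>t * R ^ N\<close>, which is \<open>N * t\<close>
  times the integral of \<open>w\<close>. Integrating in \<open>t\<close> against \<open>(p - 1) * t powr (p - 2)\<close> gives
  \<open>(p - N) / p * (\<integral> M powr p * w) \<le> (\<integral> M powr (p - 1) * h * w)\<close>, and Young's inequality concludes.
\<close>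

section \<open>Integration of radial functions in polar coordinates\<close>

text \<open>The push-forward of Lebesgue measure under \<open>norm\<close> and the weighted measure
  on the half-line both give \<open>{..a}\<close> with \<open>a \<ge> 0\<close> the volume of the
  ball of radius \<open>a\<close>. Such rays form an intersection-stable generator of the Borel
  sets, so the two measures coincide. The radius \<open>0\<close> is discarded at the end as a null
  set.\<close>

lemma nn_integral_lborel_radial:
  fixes F :: "real \<Rightarrow> ennreal"
  assumes [measurable]: "F \<in> borel_measurable borel"
  defines "N \<equiv> DIM('a::euclidean_space)"
  shows "(\<integral>\<^sup>+x. F (norm (x::'a)) \<partial>lborel) =
         ennreal (real N * unit_ball_vol (real N)) *
         (\<integral>\<^sup>+r. ennreal (r ^ (N - 1)) * indicator {0<..} r * F r \<partial>lborel)"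
proof -
  define k where "k = real N * unit_ball_vol (real N)"
  have N: "N > 0" and k: "k \<ge> 0"
    by (auto simp: N_def k_def)
  let ?D = "density lborel (\<lambda>r::real. ennreal k * (ennreal (r ^ (N - 1)) * indicator {0..} r))"
  let ?M = "distr lborel borel (norm :: 'a \<Rightarrow> real)"
  have eq: "emeasure ?M {..a} = emeasure ?D {..a}" for a :: real
  proof (cases "a \<ge> 0")
    case True
    have "emeasure ?M {..a} = emeasure lborel (cball (0::'a) a)"
      by (subst emeasure_distr) (auto simp: vimage_def cball_def)
    also have "\<dots> = ennreal (unit_ball_vol (real N) * a ^ N)"
      using True by (simp add: emeasure_cball N_def)
    finally have 1: "emeasure ?M {..a} = ennreal (unit_ball_vol (real N) * a ^ N)" .
    have "emeasure ?D {..a} = (\<integral>\<^sup>+r. ennreal k * (ennreal (r ^ (N - 1)) * indicator {0..a} r) \<partial>lborel)"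
      by (subst emeasure_density) (auto intro!: nn_integral_cong split: split_indicator)
    also have "\<dots> = ennreal k * (\<integral>\<^sup>+r. ennreal (r ^ (N - 1)) * indicator {0..a} r \<partial>lborel)"
      by (subst nn_integral_cmult) auto
    also have "(\<integral>\<^sup>+r. ennreal (r ^ (N - 1)) * indicator {0..a} r \<partial>lborel) = ennreal (a ^ N / N - 0 ^ N / N)"
      using True N
      by (intro nn_integral_FTC_Icc)
        (auto intro!: derivative_eq_intros)
    also have "ennreal k * \<dots> = ennreal (unit_ball_vol (real N) * a ^ N)"
      using True N k by (simp add: k_def zero_power flip: ennreal_mult)
    finally show ?thesis using 1 by simp
  next
    case False
    have e: "norm -` {..a} = ({}::'a set)"
      using False by (auto dest: order_trans[OF norm_ge_zero])
    have "emeasure ?M {..a} = 0"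
      by (subst emeasure_distr) (auto simp: e)
    moreover have "emeasure ?D {..a} = (\<integral>\<^sup>+r. 0 \<partial>(lborel :: real measure))"
      using False
      by (subst emeasure_density, simp, simp, intro nn_integral_cong) (auto split: split_indicator)
    ultimately show ?thesis by simp
  qed
  have "?M = ?D"
  proof (rule measure_eqI_generator_eq)
    show "Int_stable (range (\<lambda>a::real. {..a}))"
      by (auto simp: Int_stable_def Int_atMost)
    show "emeasure ?M X = emeasure ?D X" if "X \<in> range (\<lambda>a. {..a})" for X
      using that eq by auto
    show "sets ?M = sigma_sets UNIV (range (\<lambda>a::real. {..a}))"
      by (simp add: borel_eq_atMost)
    show "sets ?D = sigma_sets UNIV (range (\<lambda>a::real. {..a}))"
      by (simp add: borel_eq_atMost)
    show "(\<Union>i. {..real i}) = UNIV"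
      using real_arch_simple by auto
    show "emeasure ?M {..real i} \<noteq> \<infinity>" for i
    proof -
      have "emeasure ?M {..real i} = emeasure lborel (cball (0::'a) (real i))"
        by (subst emeasure_distr) (auto simp: vimage_def cball_def)
      then show ?thesis by (simp add: emeasure_cball)
    qed
  qed auto
  then have "(\<integral>\<^sup>+x. F x \<partial>?M) = (\<integral>\<^sup>+x. F x \<partial>?D)" by simp
  then have "(\<integral>\<^sup>+x. F (norm (x::'a)) \<partial>lborel) =
      ennreal k * (\<integral>\<^sup>+r. ennreal (r ^ (N - 1)) * indicator {0..} r * F r \<partial>lborel)"
    by (simp add: nn_integral_distr nn_integral_density nn_integral_cmult mult.assoc)
  also have "(\<integral>\<^sup>+r. ennreal (r ^ (N - 1)) * indicator {0..} r * F r \<partial>lborel) =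
      (\<integral>\<^sup>+r. ennreal (r ^ (N - 1)) * indicator {0<..} r * F r \<partial>lborel)"
  proof (rule nn_integral_cong_AE)
    show "AE r in lborel. ennreal (r ^ (N - 1)) * indicator {0..} r * F r =
        ennreal (r ^ (N - 1)) * indicator {0<..} r * F r"
      using AE_lborel_singleton[of 0] by eventually_elim (auto split: split_indicator)
  qed
  finally show ?thesis by (simp add: k_def)
qed

section \<open>Layer cake formula and Young's inequality\<close>

lemma nn_integral_indicator_has_integral:
  fixes f :: "'a::euclidean_space \<Rightarrow> real"
  assumes [measurable]: "f \<in> borel_measurable borel" "A \<in> sets borel"
    and nonneg: "\<And>x. x \<in> A \<Longrightarrow> 0 \<le> f x" and I: "(f has_integral I) A"
  shows "(\<integral>\<^sup>+x. ennreal (f x) * indicator A x \<partial>lborel) = ennreal I"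
proof -
  have "((\<lambda>x. if x \<in> A then f x else 0) has_integral I) UNIV"
    using I by (simp add: has_integral_restrict_UNIV)
  then have "(\<integral>\<^sup>+x. ennreal (if x \<in> A then f x else 0) \<partial>lborel) = ennreal I"
    using nonneg by (intro nn_integral_has_integral_lborel) auto
  moreover have "(\<integral>\<^sup>+x. ennreal (if x \<in> A then f x else 0) \<partial>lborel) =
      (\<integral>\<^sup>+x. ennreal (f x) * indicator A x \<partial>lborel)"
    by (intro nn_integral_cong) (auto split: split_indicator)
  ultimately show ?thesis by simp
qed

text \<open>Tonelli's theorem, with the inner integral over \<open>0 < t < M r\<close> computed for
  fixed \<open>r\<close>. The general weight \<open>\<phi>\<close> allows two uses: a pure power of
  \<open>r\<close> with \<open>q = p\<close>, and a weight that itself contains \<open>M\<close>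
  with \<open>q = p - 1\<close>.\<close>

lemma nn_integral_powr_layer_cake:
  fixes M :: "real \<Rightarrow> real" and \<phi> :: "real \<Rightarrow> ennreal"
  assumes [measurable]: "M \<in> borel_measurable borel" "\<phi> \<in> borel_measurable borel"
    and M: "\<And>r. M r \<ge> 0" and q: "q > 0"
  shows "(\<integral>\<^sup>+t. ennreal (q * t powr (q - 1)) * indicator {0<..} t *
            (\<integral>\<^sup>+r. \<phi> r * indicator {r. t < M r} r \<partial>lborel) \<partial>lborel) =
         (\<integral>\<^sup>+r. \<phi> r * ennreal (M r powr q) \<partial>lborel)"
proof -
  have [measurable]: "Measurable.pred (borel \<Otimes>\<^sub>M borel) (\<lambda>(t, r). t < M r)"
    by simp
  have "(\<integral>\<^sup>+t. ennreal (q * t powr (q - 1)) * indicator {0<..} t *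
            (\<integral>\<^sup>+r. \<phi> r * indicator {r. t < M r} r \<partial>lborel) \<partial>lborel) =
        (\<integral>\<^sup>+t. (\<integral>\<^sup>+r. ennreal (q * t powr (q - 1)) * indicator {0<..} t *
            (\<phi> r * indicator {r. t < M r} r) \<partial>lborel) \<partial>lborel)"
    by (subst nn_integral_cmult) auto
  also have "\<dots> = (\<integral>\<^sup>+r. (\<integral>\<^sup>+t. ennreal (q * t powr (q - 1)) * indicator {0<..} t *
            (\<phi> r * indicator {r. t < M r} r) \<partial>lborel) \<partial>lborel)"
    by (rule lborel_pair.Fubini') (simp add: indicator_def)
  also have "\<dots> = (\<integral>\<^sup>+r. \<phi> r * ennreal (M r powr q) \<partial>lborel)"
  proof (rule nn_integral_cong)
    fix r :: real
    have "((\<lambda>t. q * t powr (q - 1)) has_integral q * (M r powr (q - 1 + 1) / (q - 1 + 1))) {0..M r}"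
      using q M by (intro has_integral_mult_right has_integral_powr_from_0) auto
    then have I: "(\<integral>\<^sup>+t. ennreal (q * t powr (q - 1)) * indicator {0..M r} t \<partial>lborel)
        = ennreal (M r powr q)"
      using q by (subst nn_integral_indicator_has_integral) auto
    have "(\<integral>\<^sup>+t. ennreal (q * t powr (q - 1)) * indicator {0<..} t *
            (\<phi> r * indicator {r. t < M r} r) \<partial>lborel)
        = (\<integral>\<^sup>+t. \<phi> r * (ennreal (q * t powr (q - 1)) * indicator {0..M r} t) \<partial>lborel)"
    \<comment> \<open>Only \<open>t = M r\<close> has to be excluded: at \<open>t = 0\<close> both
      sides vanish because \<open>0 powr x = 0\<close>.\<close>
    proof (rule nn_integral_cong_AE)
      have "AE t in lborel. t \<noteq> M r" by (rule AE_lborel_singleton)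
      then show "AE t in lborel. ennreal (q * t powr (q - 1)) * indicator {0<..} t *
            (\<phi> r * indicator {r. t < M r} r) = \<phi> r * (ennreal (q * t powr (q - 1)) * indicator {0..M r} t)"
        by eventually_elim (auto split: split_indicator simp: mult_ac)
    qed
    also have "\<dots> = \<phi> r * ennreal (M r powr q)"
      by (subst nn_integral_cmult) (auto simp: I)
    finally show "(\<integral>\<^sup>+t. ennreal (q * t powr (q - 1)) * indicator {0<..} t *
            (\<phi> r * indicator {r. t < M r} r) \<partial>lborel) = \<phi> r * ennreal (M r powr q)" .
  qed
  finally show ?thesis .
qed

text \<open>Young's inequality with exponents \<open>p / (p - 1)\<close> and \<open>p\<close>, after
  moving a factor \<open>c powr ((p - 1) / p)\<close> from \<open>b\<close> to \<open>a\<close>. The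
  parameter \<open>c\<close> is kept free so that the term in \<open>a powr p\<close> can later be
  made small enough to absorb.\<close>

lemma powr_Young:
  fixes a b c p :: real
  assumes "a \<ge> 0" "b \<ge> 0" "c > 0" "p > 1"
  shows "a powr (p - 1) * b \<le> c * (p - 1) / p * a powr p + c powr (1 - p) / p * b powr p"
proof -
  define e q where "e = (p - 1) / p" and "q = p / (p - 1)"
  have q: "q > 1" "1 / q + 1 / p = 1" "(p - 1) * q = p" "e * q = 1" "- e * p = 1 - p" "1 / q = e"
    using assms by (auto simp: e_def q_def divide_simps)
  have "a powr (p - 1) * b = (a powr (p - 1) * c powr e) * (b * c powr (- e))"
    using assms by (simp add: powr_minus)
  also have "\<dots> \<le> (a powr (p - 1) * c powr e) powr q / q + (b * c powr (- e)) powr p / p"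
    using assms q by (intro Youngs_inequality) auto
  also have "(a powr (p - 1) * c powr e) powr q = a powr p * c"
    using assms q by (simp add: powr_mult powr_powr)
  also have "(b * c powr (- e)) powr p = b powr p * c powr (1 - p)"
    using assms q by (simp add: powr_mult powr_powr)
  also have "a powr p * c / q = c * (p - 1) / p * a powr p"
    by (simp add: q_def)
  finally show ?thesis by (simp add: mult.commute)
qed

section \<open>The gradient and directional derivatives\<close>

text \<open>Since \<open>grad\<close> is a definite description, a candidate vector is built from
  the values of \<open>A\<close> on the basis, and uniqueness of the derivative identifies it with
  \<open>grad u x\<close>.\<close>

lemma inner_grad:
  fixes u :: "'a::euclidean_space \<Rightarrow> real"
  assumes "(u has_derivative A) (at x)"
  shows "v \<bullet> grad u x = A v"
proof -
  interpret linear A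
    using assms has_derivative_linear by blast
  let ?D = "\<Sum>b\<in>Basis. A b *\<^sub>R b"
  have A: "v \<bullet> ?D = A v" for v
  proof -
    have "A v = A (\<Sum>b\<in>Basis. (v \<bullet> b) *\<^sub>R b)"
      by (simp add: euclidean_representation)
    also have "\<dots> = (\<Sum>b\<in>Basis. (v \<bullet> b) * A b)"
      by (simp add: sum scale)
    finally show ?thesis
      by (simp add: inner_sum_right mult.commute)
  qed
  have "GDERIV u x :> ?D"
    unfolding gderiv_def A using assms by simp
  moreover have "D = ?D" if "GDERIV u x :> D" for D
  proof -
    have "(\<lambda>h. h \<bullet> D) = A"
      using that assms unfolding gderiv_def by (rule has_derivative_unique)
    then have "\<forall>h. h \<bullet> D = h \<bullet> ?D"
      unfolding A by (simp add: fun_eq_iff)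
    then show ?thesis
      by (simp only: vector_eq_ldot)
  qed
  ultimately have "grad u x = ?D"
    unfolding grad_def by (rule the_equality)
  then show ?thesis by (simp only: A)
qed

section \<open>Averages of a one-dimensional profile and their maximal function\<close>

text \<open>Abstracts the absolute radial derivative of \<open>u\<close>. Continuity bounds the
  averages \<open>g s / s\<close> near the origin; vanishing beyond \<open>b\<close> bounds
  \<open>g\<close>, which makes \<open>M\<close> decay at infinity.\<close>

locale radial_profile =
  fixes h :: "real \<Rightarrow> real" and b :: real
  assumes cont: "continuous_on UNIV h"
    and nonneg: "\<And>r. h r \<ge> 0"
    and vanish: "\<And>r. r \<ge> b \<Longrightarrow> h r = 0"
begin

definition g :: "real \<Rightarrow> real" where
  "g r = integral {0..r} h"

text \<open>Only positive \<open>s\<close> are admitted, so that \<open>M\<close> is bounded and decreasing on the whole real line.\<close>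

definition M :: "real \<Rightarrow> real" where
  "M r = (SUP s \<in> {r..} \<inter> {0<..}. g s / s)"

lemma integrable: "h integrable_on {x..y}"
  using cont by (intro integrable_continuous_interval) (auto intro: continuous_on_subset)

lemma h_measurable [measurable]: "h \<in> borel_measurable borel"
  using cont by (rule borel_measurable_continuous_onI)

lemma g_nonneg: "g r \<ge> 0"
  unfolding g_def using nonneg by (intro integral_nonneg integrable) auto

lemma g_mono: "r \<le> s \<Longrightarrow> g r \<le> g s"
  unfolding g_def using nonneg by (intro integral_subset_le integrable) auto

lemma g_le: "g r \<le> g b"
proof (cases "r \<le> b \<or> r < 0")
  case True
  then show ?thesis
    using g_mono[of r b] g_nonneg[of b] by (auto simp: g_def[of r])
next
  case False
  then have r: "r > b" "r \<ge> 0" by auto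
  have "integral {max 0 b..r} h = integral {max 0 b..r} (\<lambda>_. 0)"
    by (rule integral_cong) (use vanish in auto)
  then have 0: "integral {max 0 b..r} h = 0" by simp
  \<comment> \<open>For \<open>b < 0\<close> the profile vanishes on all of \<open>{0..r}\<close>,
    and \<open>g b\<close> is an integral over an empty interval, so both sides are
    \<open>0\<close>.\<close>
  show ?thesis
  proof (cases "b \<ge> 0")
    case True
    then show ?thesis
      using Henstock_Kurzweil_Integration.integral_combine[OF _ _ integrable, of 0 b r] r 0 by (simp add: g_def max_def)
  next
    case False
    then show ?thesis
      using 0 by (simp add: g_def max_def)
  qed
qed

text \<open>The quotient is the mean of \<open>h\<close> over \<open>{0..s}\<close>, hence at most
  the supremum of \<open>h\<close> on the half-line.\<close>

lemma g_quotient_le: obtains H where "\<And>s. s > 0 \<Longrightarrow> g s / s \<le> H"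
proof -
  have "compact (h ` {0..b})"
    using cont by (intro compact_continuous_image) (auto intro: continuous_on_subset)
  then obtain H where "\<forall>y\<in>h ` {0..b}. norm y \<le> H"
    by (meson compact_imp_bounded bounded_iff)
  then have "norm (h x) \<le> H" if "x \<in> {0..b}" for x
    using that by blast
  then have H: "h x \<le> H" if "x \<in> {0..b}" for x
    using that nonneg[of x] by (metis abs_of_nonneg real_norm_def)
  \<comment> \<open>For \<open>b < 0\<close> the constant \<open>H\<close> bounds an empty set and
    may be negative, hence the maximum with \<open>0\<close>.\<close>
  have H: "h x \<le> max 0 H" if "x \<ge> 0" for x
    using H[of x] vanish[of x] that by (cases "x \<le> b") auto
  have "g s / s \<le> max 0 H" if "s > 0" for s
  proof -
    have "g s \<le> integral {0..s} (\<lambda>_. max 0 H)"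
      unfolding g_def using H by (intro integral_le integrable) auto
    then show ?thesis using that by (simp add: divide_le_eq mult.commute)
  qed
  then show ?thesis by (rule that)
qed

lemma bdd_above_g_quotient: "bdd_above ((\<lambda>s. g s / s) ` ({r..} \<inter> {0<..}))"
proof -
  obtain H where "\<And>s. s > 0 \<Longrightarrow> g s / s \<le> H"
    using g_quotient_le by blast
  then show ?thesis by (intro bdd_aboveI2[where M = H]) auto
qed

lemma domain_nonempty: "{r::real..} \<inter> {0<..} \<noteq> {}"
proof -
  have "max r 1 \<in> {r..} \<inter> {0<..}" by auto
  then show ?thesis by blast
qed

lemma M_upper: "r \<le> s \<Longrightarrow> 0 < s \<Longrightarrow> g s / s \<le> M r"
  unfolding M_def by (rule cSUP_upper[OF _ bdd_above_g_quotient]) auto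

lemma M_nonneg: "M r \<ge> 0"
proof -
  have "0 \<le> g (max r 1) / max r 1" using g_nonneg by simp
  also have "\<dots> \<le> M r" by (rule M_upper) auto
  finally show ?thesis .
qed

lemma M_antimono: "r \<le> s \<Longrightarrow> M s \<le> M r"
  unfolding M_def by (rule cSUP_subset_mono[OF domain_nonempty bdd_above_g_quotient]) auto

lemma M_measurable [measurable]: "M \<in> borel_measurable borel"
proof -
  have "(\<lambda>r. - M r) \<in> borel_measurable borel"
    by (rule borel_measurable_mono) (auto intro!: monoI M_antimono)
  then show ?thesis by simp
qed

lemma M_le: "r > 0 \<Longrightarrow> M r \<le> g b / r"
  unfolding M_def
proof (rule cSUP_least[OF domain_nonempty])
  fix s assume "r > 0" "s \<in> {r..} \<inter> {0<..}"
  then show "g s / s \<le> g b / r"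
    using g_le[of s] g_nonneg[of s] by (auto intro!: frac_le order_trans[OF g_nonneg g_le])
qed

lemma less_M_iff: "t < M r \<longleftrightarrow> (\<exists>s\<ge>r. s > 0 \<and> t < g s / s)"
  unfolding M_def by (subst less_cSUP_iff[OF domain_nonempty bdd_above_g_quotient]) auto

section \<open>The estimate on a level set of the maximal function\<close>

lemma g_power_has_integral:
  assumes "R \<ge> 0"
  shows "((\<lambda>r. h r * r ^ n + real n * g r * r ^ (n - 1)) has_integral g R * R ^ n) {0..R}"
proof -
  have d: "(g has_real_derivative h r) (at r within {0..R})" if "r \<in> {0..R}" for r
    unfolding g_def using that cont
    by (intro integral_has_real_derivative) (auto intro: continuous_on_subset)
  have "((\<lambda>r. h r * r ^ n + real n * g r * r ^ (n - 1)) has_integral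
      g R * R ^ n - g 0 * 0 ^ n) {0..R}"
  proof (rule fundamental_theorem_of_calculus[OF assms])
    fix r assume r: "r \<in> {0..R}"
    have "((\<lambda>r. g r * r ^ n) has_real_derivative h r * r ^ n + real n * g r * r ^ (n - 1))
        (at r within {0..R})"
      by (rule derivative_eq_intros d r refl | simp)+
    then show "((\<lambda>r. g r * r ^ n) has_vector_derivative
        h r * r ^ n + real n * g r * r ^ (n - 1)) (at r within {0..R})"
      by (rule has_real_derivative_iff_has_vector_derivative[THEN iffD1])
  qed
  \<comment> \<open>The boundary term at \<open>0\<close> drops because \<open>g 0 = 0\<close>; for
    \<open>n = 0\<close> the factor \<open>0 ^ n\<close> is \<open>1\<close> and would not remove
    it.\<close>
  then show ?thesis by (simp add: g_def)
qed

text \<open>On the level set the average \<open>g r / r\<close> is replaced by the larger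
  \<open>M r\<close>. Both sides then carry the same level set as a cut-off, so the layer cake
  formula applies to each when integrating in \<open>t\<close>.\<close>

lemma layer_le:
  assumes t: "t > 0"
  shows "ennreal (real (Suc n) * t) *
           (\<integral>\<^sup>+r. ennreal (r ^ n) * indicator {0<..} r * indicator {r. t < M r} r \<partial>lborel)
       \<le> (\<integral>\<^sup>+r. ennreal ((h r + real n * M r) * r ^ n) * indicator {0<..} r *
              indicator {r. t < M r} r \<partial>lborel)"
proof (cases "\<exists>r. t < M r")
  case False
  then show ?thesis by simp
next
  case True
  define S where "S = {s. s > 0 \<and> t < g s / s}"
  define R where "R = Sup S"
  have S: "S \<noteq> {}" using True by (auto simp: less_M_iff S_def)
  have St: "t * s < g s" "s > 0" if "s \<in> S" for s
    using that by (auto simp: S_def field_simps)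
  have "s \<le> g b / t" if "s \<in> S" for s
    using St[OF that] g_le[of s] t by (simp add: field_simps)
  then have bdd: "bdd_above S" by (rule bdd_aboveI)
  have upper: "s \<le> R" if "s \<in> S" for s
    unfolding R_def using that bdd by (rule cSup_upper)
  have R: "R > 0" using S upper St(2) by (meson ex_in_conv less_le_trans)
  \<comment> \<open>Monotonicity of \<open>g\<close> carries the inequality over to the supremum:
    \<open>t * s < g s \<le> g R\<close> for every \<open>s\<close> in \<open>S\<close>.\<close>
  have "R \<le> g R / t"
    unfolding R_def
  proof (rule cSup_least[OF S])
    fix s assume s: "s \<in> S"
    have "t * s \<le> g R" using St(1)[OF s] g_mono[OF upper[OF s]] by simp
    then show "s \<le> g (Sup S) / t" using t by (simp add: field_simps R_def)
  qed
  then have gR: "t * R \<le> g R" using t by (simp add: field_simps)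
  \<comment> \<open>This fact and the next squeeze the level set between \<open>{..<R}\<close> and
    \<open>{..R}\<close>; membership of the endpoint \<open>R\<close> is left open and is harmless
    up to a null set.\<close>
  have sub: "r \<le> R" if "t < M r" for r
    using that upper by (force simp: less_M_iff S_def)
  have sup: "t < M r" if r: "r < R" for r
  proof -
    obtain s where "s \<in> S" "r < s"
      using r less_cSup_iff[OF S bdd, of r] unfolding R_def by blast
    then show ?thesis by (auto simp: less_M_iff S_def intro!: exI[of _ s])
  qed
  have [measurable]: "g \<in> borel_measurable borel"
    by (rule borel_measurable_mono) (auto intro!: monoI g_mono)
  have "(\<integral>\<^sup>+r. ennreal (r ^ n) * indicator {0<..} r * indicator {r. t < M r} r \<partial>lborel)
      \<le> (\<integral>\<^sup>+r. ennreal (r ^ n) * indicator {0..R} r \<partial>lborel)"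
    using sub by (intro nn_integral_mono) (auto split: split_indicator)
  also have "\<dots> = ennreal (R ^ Suc n / real (Suc n) - 0 ^ Suc n / real (Suc n))"
  proof (intro nn_integral_FTC_Icc)
    fix r :: real
    show "((\<lambda>r. r ^ Suc n / real (Suc n)) has_real_derivative r ^ n) (at r)"
      by (rule DERIV_cong[OF DERIV_cdivide[OF DERIV_pow]]) (simp del: of_nat_Suc)
  qed (use R in auto)
  finally have "ennreal (real (Suc n) * t) *
           (\<integral>\<^sup>+r. ennreal (r ^ n) * indicator {0<..} r * indicator {r. t < M r} r \<partial>lborel)
      \<le> ennreal (real (Suc n) * t) * ennreal (R ^ Suc n / real (Suc n) - 0 ^ Suc n / real (Suc n))"
    by (rule mult_left_mono) simp
  also have "\<dots> = ennreal (t * R * R ^ n)"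
    using t R by (subst ennreal_mult[symmetric]) (auto simp del: of_nat_Suc)
  also have "\<dots> \<le> ennreal (g R * R ^ n)"
    using R gR by (intro ennreal_leI mult_right_mono) auto
  also have "\<dots> = (\<integral>\<^sup>+r. ennreal (h r * r ^ n + real n * g r * r ^ (n - 1)) * indicator {0..R} r \<partial>lborel)"
    using R nonneg g_nonneg
    by (intro nn_integral_indicator_has_integral[symmetric] g_power_has_integral) auto
  also have "\<dots> \<le> (\<integral>\<^sup>+r. ennreal ((h r + real n * M r) * r ^ n) * indicator {0<..} r *
              indicator {r. t < M r} r \<partial>lborel)"
  proof (rule nn_integral_mono_AE)
    have "AE r in lborel. r \<noteq> 0 \<and> r \<noteq> R"
      using AE_lborel_singleton[of 0] AE_lborel_singleton[of R] by auto
    then show "AE r in lborel. ennreal (h r * r ^ n + real n * g r * r ^ (n - 1)) * indicator {0..R} r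
        \<le> ennreal ((h r + real n * M r) * r ^ n) * indicator {0<..} r * indicator {r. t < M r} r"
    proof eventually_elim
      case (elim r)
      show ?case
      proof (cases "0 < r \<and> r < R")
        case False
        then show ?thesis using elim by (auto split: split_indicator)
      next
        case True
        \<comment> \<open>Rewritten to expose the average \<open>g r / r\<close>. For
          \<open>n = 0\<close>, where \<open>n - 1\<close> truncates to \<open>0\<close>, both sides
          vanish.\<close>
        have "real n * g r * r ^ (n - 1) = real n * (g r / r) * r ^ n"
          using True by (cases n) auto
        also have "\<dots> \<le> real n * M r * r ^ n"
          using True M_upper[of r r] by (intro mult_mono mult_left_mono) (auto simp: M_nonneg)
        finally have "h r * r ^ n + real n * g r * r ^ (n - 1) \<le> (h r + real n * M r) * r ^ n"
          by (simp add: algebra_simps)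
        then show ?thesis using True sup[of r] by (auto intro: ennreal_leI)
      qed
    qed
  qed
  finally show ?thesis .
qed

section \<open>The Hardy inequality on the half-line\<close>

text \<open>Finiteness is what permits absorbing a multiple of this integral in
  \<open>Hardy_sup\<close>. Near \<open>0\<close> the function \<open>M\<close> is bounded by
  \<open>M 0\<close>; beyond \<open>1\<close> it is at most \<open>g b / r\<close>, and the
  resulting exponent \<open>n - p\<close> is below \<open>-1\<close>.\<close>

lemma M_powr_finite:
  assumes p: "real (Suc n) < p"
  shows "(\<integral>\<^sup>+r. ennreal (r ^ n) * indicator {0<..} r * ennreal (M r powr p) \<partial>lborel) < \<infinity>"
proof -
  have "(\<integral>\<^sup>+r. ennreal (r ^ n) * indicator {0<..} r * ennreal (M r powr p) \<partial>lborel)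
    \<le> (\<integral>\<^sup>+r. ennreal (M 0 powr p) * indicator {0..1} r +
          ennreal (g b powr p) * (ennreal (r powr (real n - p)) * indicator {1..} r) \<partial>lborel)"
  proof (rule nn_integral_mono)
    fix r :: real
    consider "r \<le> 0" | "0 < r" "r \<le> 1" | "r > 1" by linarith
    then show "ennreal (r ^ n) * indicator {0<..} r * ennreal (M r powr p)
      \<le> ennreal (M 0 powr p) * indicator {0..1} r +
          ennreal (g b powr p) * (ennreal (r powr (real n - p)) * indicator {1..} r)"
    proof cases
      case 2
      have "r ^ n * M r powr p \<le> 1 * M 0 powr p"
        using 2 p by (intro mult_mono power_le_one powr_mono2 M_antimono M_nonneg) auto
      then show ?thesis
        using 2 by (auto simp: ennreal_mult[symmetric] intro!: add_increasing2 ennreal_leI)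
    next
      case 3
      have "r ^ n * M r powr p \<le> r ^ n * (g b / r) powr p"
        using 3 p by (intro mult_left_mono powr_mono2 M_le M_nonneg) auto
      also have "\<dots> = g b powr p * r powr (real n - p)"
        using 3 g_nonneg by (simp add: powr_divide powr_diff powr_realpow)
      finally show ?thesis
        using 3 by (auto simp: ennreal_mult[symmetric] intro!: ennreal_leI)
    qed auto
  qed
  also have "\<dots> = ennreal (M 0 powr p) + ennreal (g b powr p) *
      (\<integral>\<^sup>+r. ennreal (r powr (real n - p)) * indicator {1..} r \<partial>lborel)"
    by (subst nn_integral_add) (auto simp: nn_integral_cmult)
  also have "(\<integral>\<^sup>+r. ennreal (r powr (real n - p)) * indicator {1..} r \<partial>lborel) =
      ennreal (- (1 powr (real n - p + 1)) / (real n - p + 1))"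
    using p by (intro nn_integral_indicator_has_integral has_integral_powr_to_inf) auto
  also have "ennreal (M 0 powr p) + ennreal (g b powr p) * \<dots> < \<infinity>"
    by (simp add: ennreal_mult_less_top)
  finally show ?thesis .
qed

lemma Hardy_sup:
  assumes p: "real (Suc n) < p"
  shows "(\<integral>\<^sup>+r. ennreal (r ^ n) * indicator {0<..} r * ennreal (M r powr p) \<partial>lborel)
     \<le> ennreal ((p / (p - real (Suc n))) powr p) *
        (\<integral>\<^sup>+r. ennreal (r ^ n) * indicator {0<..} r * ennreal (h r powr p) \<partial>lborel)"
    (is "?I \<le> _ * ?J")
proof -
  define N where "N = real (Suc n)"
  \<comment> \<open>This Young parameter minimises the constant that the argument yields.\<close>
  define c where "c = (p - N) / p"
  have N: "N \<ge> 1" and p1: "p > 1" and c: "c > 0" and n: "real n = N - 1"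
    using p by (auto simp: N_def c_def)
  \<comment> \<open>\<open>X\<close> arises from multiplying \<open>layer_le\<close> by
    \<open>(p - 1) * t powr (p - 2)\<close>: the factor \<open>N * t\<close> turns this weight into
    \<open>X * (p * t powr (p - 1))\<close>. \<open>Y\<close> collects the Young coefficient of
    \<open>M r powr p\<close> and the summand \<open>n * M\<close>; \<open>Z\<close> is the Young
    coefficient of \<open>h r powr p\<close>.\<close>
  define X where "X = N * (p - 1) / p"
  define Y where "Y = c * (p - 1) / p + real n"
  define Z where "Z = c powr (1 - p) / p"
  have XY: "X - Y = c / p"
    using p1 by (simp add: X_def Y_def c_def n field_simps)
  have X: "X \<ge> 0" and Y: "Y \<ge> 0" and Z: "Z \<ge> 0"
    using p1 N c by (auto simp: X_def Y_def Z_def)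
  have "ennreal X * ?I = ennreal X *
      (\<integral>\<^sup>+t. ennreal (p * t powr (p - 1)) * indicator {0<..} t *
          (\<integral>\<^sup>+r. ennreal (r ^ n) * indicator {0<..} r * indicator {r. t < M r} r \<partial>lborel) \<partial>lborel)"
    using p1 by (subst nn_integral_powr_layer_cake) (auto simp: M_nonneg)
  also have "\<dots> = (\<integral>\<^sup>+t. ennreal X * (ennreal (p * t powr (p - 1)) * indicator {0<..} t *
          (\<integral>\<^sup>+r. ennreal (r ^ n) * indicator {0<..} r * indicator {r. t < M r} r \<partial>lborel)) \<partial>lborel)"
    by (subst nn_integral_cmult) auto
  also have "\<dots> \<le> (\<integral>\<^sup>+t. ennreal ((p - 1) * t powr (p - 1 - 1)) * indicator {0<..} t *
          (\<integral>\<^sup>+r. ennreal ((h r + real n * M r) * r ^ n) * indicator {0<..} r *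
              indicator {r. t < M r} r \<partial>lborel) \<partial>lborel)"
  proof (rule nn_integral_mono)
    fix t :: real
    let ?A = "\<integral>\<^sup>+r. ennreal (r ^ n) * indicator {0<..} r * indicator {r. t < M r} r \<partial>lborel"
    let ?B = "\<integral>\<^sup>+r. ennreal ((h r + real n * M r) * r ^ n) * indicator {0<..} r *
              indicator {r. t < M r} r \<partial>lborel"
    show "ennreal X * (ennreal (p * t powr (p - 1)) * indicator {0<..} t * ?A)
      \<le> ennreal ((p - 1) * t powr (p - 1 - 1)) * indicator {0<..} t * ?B"
    proof (cases "t > 0")
      case True
      have "t powr (p - 1) = t powr (p - 1 - 1) * t"
        using True powr_diff[of t "p - 1" 1] by simp
      then have "X * (p * t powr (p - 1)) = ((p - 1) * t powr (p - 1 - 1)) * (N * t)"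
        using p1 by (simp add: X_def)
      then have "ennreal X * ennreal (p * t powr (p - 1)) =
          ennreal ((p - 1) * t powr (p - 1 - 1)) * ennreal (N * t)"
        using X p1 N True by (simp add: ennreal_mult[symmetric])
      then have "ennreal X * (ennreal (p * t powr (p - 1)) * indicator {0<..} t * ?A)
          = ennreal ((p - 1) * t powr (p - 1 - 1)) * (ennreal (N * t) * ?A)"
        using True by (simp add: mult.assoc[symmetric])
      also have "\<dots> \<le> ennreal ((p - 1) * t powr (p - 1 - 1)) * ?B"
        using layer_le[OF True, of n] unfolding N_def by (rule mult_left_mono) simp
      finally show ?thesis using True by simp
    qed auto
  qed
  also have "\<dots> = (\<integral>\<^sup>+r. ennreal ((h r + real n * M r) * r ^ n) * indicator {0<..} r *
      ennreal (M r powr (p - 1)) \<partial>lborel)"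
    using p1 by (intro nn_integral_powr_layer_cake) (auto simp: M_nonneg)
  also have "\<dots> \<le> (\<integral>\<^sup>+r. ennreal Y * (ennreal (r ^ n) * indicator {0<..} r * ennreal (M r powr p)) +
      ennreal Z * (ennreal (r ^ n) * indicator {0<..} r * ennreal (h r powr p)) \<partial>lborel)"
  proof (rule nn_integral_mono)
    fix r :: real
    show "ennreal ((h r + real n * M r) * r ^ n) * indicator {0<..} r * ennreal (M r powr (p - 1))
      \<le> ennreal Y * (ennreal (r ^ n) * indicator {0<..} r * ennreal (M r powr p)) +
        ennreal Z * (ennreal (r ^ n) * indicator {0<..} r * ennreal (h r powr p))"
    proof (cases "r > 0")
      case True
      have MM: "M r * M r powr (p - 1) = M r powr p"
        using M_nonneg[of r] p1 by (cases "M r = 0") (auto simp: powr_diff)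
      have "(h r + real n * M r) * M r powr (p - 1) = M r powr (p - 1) * h r + real n * M r powr p"
        by (simp add: algebra_simps flip: MM)
      also have "\<dots> \<le> Y * M r powr p + Z * h r powr p"
        using powr_Young[of "M r" "h r" c p] M_nonneg[of r] nonneg[of r] c p1
        by (simp add: Y_def Z_def algebra_simps)
      finally have "((h r + real n * M r) * M r powr (p - 1)) * r ^ n
          \<le> (Y * M r powr p + Z * h r powr p) * r ^ n"
        using True by (intro mult_right_mono) auto
      then have "(h r + real n * M r) * r ^ n * M r powr (p - 1)
          \<le> Y * (r ^ n * M r powr p) + Z * (r ^ n * h r powr p)"
        by (simp add: algebra_simps)
      then show ?thesis
        using True Y Z nonneg[of r] M_nonneg[of r]
        by (simp add: ennreal_mult[symmetric] ennreal_plus[symmetric] ennreal_leI del: ennreal_plus)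
    qed auto
  qed
  also have "\<dots> = ennreal Y * ?I + ennreal Z * ?J"
    by (subst nn_integral_add) (auto simp: nn_integral_cmult)
  finally have main: "ennreal X * ?I \<le> ennreal Y * ?I + ennreal Z * ?J" .
  \<comment> \<open>With \<open>?I\<close> finite, \<open>Y * ?I\<close> can be subtracted in the
    reals. What remains is \<open>c / p * i \<le> c powr (1 - p) / p * j\<close>, which is the claim
    with constant \<open>c powr (- p)\<close>.\<close>
  obtain i where i: "?I = ennreal i" "i \<ge> 0"
    using M_powr_finite[OF p] by (cases ?I) auto
  have k: "(p / (p - real (Suc n))) powr p = c powr (- p)"
    using p p1 N by (simp add: c_def N_def powr_minus powr_divide del: of_nat_Suc)
  show ?thesis
  proof (cases ?J)
    case (real j)
    have "X * i \<le> Y * i + Z * j"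
      using main X Y Z i real
      by (simp add: ennreal_mult[symmetric] ennreal_plus[symmetric] del: ennreal_plus)
    then have "(X - Y) * i \<le> Z * j" by (simp add: algebra_simps)
    then have "i \<le> c powr (- p) * j"
      using c p1 by (simp add: XY Z_def field_simps powr_diff powr_minus)
    then show ?thesis
      using i real k by (simp add: ennreal_mult[symmetric] ennreal_leI)
  next
    case top
    have "ennreal (c powr (- p)) \<noteq> 0" using c by simp
    then show ?thesis using top k by (simp add: ennreal_mult_top)
  qed
qed

end

section \<open>Transfer from the radial profile to the whole space\<close>

theorem theorem4p1:
  fixes u :: "'a::euclidean_space \<Rightarrow> real" and p :: real
  assumes "real DIM('a) < p"
    and "u \<in> Cc_rad_smooth"
  shows "(\<integral>\<^sup>+ (x::'a). max (SUP y \<in> cball 0 (norm x) - {0}. ennreal (\<bar>u y\<bar> powr p / norm x powr p))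
                     (SUP y \<in> - ball 0 (norm x). ennreal (\<bar>u y\<bar> powr p / norm y powr p)) \<partial>lborel)
         \<le> ennreal (\<bar>p / (real DIM('a) - p)\<bar> powr p)
           * (\<integral>\<^sup>+ x. ennreal (\<bar>(x /\<^sub>R norm x) \<bullet> grad u x\<bar> powr p) \<partial>lborel)"
proof -
  obtain n where n: "DIM('a) = Suc n"
    by (metis DIM_positive gr0_conv_Suc)
  have np: "real (Suc n) < p" and p: "p > 0"
    using assms(1) by (auto simp: n)
  have smooth: "smooth u" and comp: "compact (supp u)" and supp: "supp u \<subseteq> UNIV - {0}"
    and rad: "\<And>x y. norm x = norm y \<Longrightarrow> u x = u y"
    using assms(2) unfolding Cc_rad_smooth_def radial_def by blast+
  have "C_k (Suc 0) u" using smooth by (simp only: smooth_def)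
  then have diff: "u differentiable (at x)"
    and cont: "b \<in> Basis \<Longrightarrow> continuous_on UNIV (\<lambda>x. frechet_derivative u (at x) b)" for x b
    by (simp_all add: differentiable_on_def)
  have der: "(u has_derivative frechet_derivative u (at x)) (at x)" for x
    using diff frechet_derivative_works by blast
  \<comment> \<open>The chain rule along an arbitrary line through the origin; used for the fixed
    direction \<open>e\<close> and later for the direction of \<open>x\<close>.\<close>
  have der_ray: "((\<lambda>t. u (t *\<^sub>R v)) has_real_derivative frechet_derivative u (at (t *\<^sub>R v)) v) (at t)"
    for t v
  proof -
    interpret D: linear "frechet_derivative u (at (t *\<^sub>R v))"
      using der has_derivative_linear by blast
    have "((\<lambda>t. u (t *\<^sub>R v)) has_derivative (\<lambda>s. frechet_derivative u (at (t *\<^sub>R v)) (s *\<^sub>R v))) (at t)"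
      by (rule has_derivative_compose[OF _ der]) (auto intro!: derivative_eq_intros)
    then show ?thesis
      by (simp add: has_field_derivative_def D.scale mult.commute[of _ "frechet_derivative u (at (t *\<^sub>R v)) v"])
  qed
  obtain e :: 'a where e: "e \<in> Basis" using nonempty_Basis by blast
  define f where "f t = u (t *\<^sub>R e)" for t
  define f' where "f' t = frechet_derivative u (at (t *\<^sub>R e)) e" for t
  have f: "(f has_real_derivative f' t) (at t)" for t
    unfolding f_def[abs_def] f'_def by (rule der_ray)
  have f'_cont: "continuous_on S f'" for S
    unfolding f'_def
    by (rule continuous_on_compose2[OF cont[OF e]]) (auto intro!: continuous_intros)
  have u_f: "u y = f (norm y)" for y
    unfolding f_def by (rule rad) (simp add: e)
  have zero: "u x = 0" if "x \<notin> supp u" for x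
    using that closure_subset[of "{x. u x \<noteq> 0}"] by (auto simp: supp_def)
  obtain B where B: "\<And>x. x \<in> supp u \<Longrightarrow> norm x \<le> B"
    using compact_imp_bounded[OF comp] by (auto simp: bounded_iff)
  have f_zero: "f r = 0" if "r > B" "r > 0" for r
  proof -
    have "r *\<^sub>R e \<notin> supp u" using B[of "r *\<^sub>R e"] that e by auto
    then show ?thesis unfolding f_def by (rule zero)
  qed
  \<comment> \<open>The margin \<open>1\<close> makes \<open>f\<close> vanish on the whole open
    interval of radius \<open>1\<close> around \<open>r\<close>, whose points all exceed
    \<open>\<bar>B\<bar>\<close>.\<close>
  have f'_zero: "f' r = 0" if r: "r \<ge> \<bar>B\<bar> + 1" for r
    using f[of r]
  proof (rule DERIV_local_const[where d = 1])
    show "\<forall>y. \<bar>r - y\<bar> < 1 \<longrightarrow> f r = f y"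
      using r by (auto simp: f_zero)
  qed simp
  interpret P: radial_profile "\<lambda>t. \<bar>f' t\<bar>" "\<bar>B\<bar> + 1"
    by unfold_locales (auto simp: f'_zero intro!: continuous_intros f'_cont)
  have f_le: "\<bar>f r\<bar> \<le> P.g r" if "r \<ge> 0" for r
  proof -
    have "(f' has_integral f r - f 0) {0..r}"
      using that f by (intro fundamental_theorem_of_calculus)
        (auto simp flip: has_real_derivative_iff_has_vector_derivative intro: has_field_derivative_at_within)
    \<comment> \<open>The origin lies outside the support, so \<open>f\<close> is the primitive of
      \<open>f'\<close> starting from \<open>0\<close>.\<close>
    moreover have "f 0 = 0"
      using zero[of 0] supp by (auto simp: f_def)
    ultimately have "integral {0..r} f' = f r" by (simp add: integral_unique)
    then show ?thesis
      unfolding P.g_def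
      using integral_norm_bound_integral[of f' "{0..r}" "\<lambda>t. \<bar>f' t\<bar>"]
      by (auto intro!: integrable_continuous_interval continuous_intros f'_cont)
  qed
  \<comment> \<open>One bound serves both suprema with \<open>r = norm x\<close>: take
    \<open>s = norm x\<close> for \<open>y\<close> in the closed ball, and \<open>s = norm y\<close>
    for \<open>y\<close> outside the open ball.\<close>
  have quot: "ennreal (\<bar>u y\<bar> powr p / s powr p) \<le> ennreal (P.M r powr p)"
    if "r > 0" "r \<le> s" "norm y \<le> s" for y :: 'a and r s
  proof -
    have s: "s > 0" using that by simp
    have "\<bar>u y\<bar> \<le> P.g s"
      using f_le[of "norm y"] P.g_mono[OF that(3)] by (simp add: u_f)
    then have "\<bar>u y\<bar> / s \<le> P.M r"
      using P.M_upper[OF that(2) s] s by (meson divide_right_mono less_imp_le order_trans)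
    then have "(\<bar>u y\<bar> / s) powr p \<le> P.M r powr p"
      using s p by (intro powr_mono2) auto
    then show ?thesis
      using s by (simp add: powr_divide ennreal_leI)
  qed
  have nz: "AE x in lborel. (x :: 'a) \<noteq> 0" by (rule AE_lborel_singleton)
  define k where "k = ennreal (real DIM('a) * unit_ball_vol (real DIM('a)))"
  have polar: "(\<integral>\<^sup>+x. F (norm (x::'a)) \<partial>lborel) =
      k * (\<integral>\<^sup>+r. ennreal (r ^ n) * indicator {0<..} r * F r \<partial>lborel)"
    if "F \<in> borel_measurable borel" for F :: "real \<Rightarrow> ennreal"
    using nn_integral_lborel_radial[OF that, where 'a = 'a] by (simp add: k_def n)
  have "(\<integral>\<^sup>+ (x::'a). max (SUP y \<in> cball 0 (norm x) - {0}. ennreal (\<bar>u y\<bar> powr p / norm x powr p))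
                     (SUP y \<in> - ball 0 (norm x). ennreal (\<bar>u y\<bar> powr p / norm y powr p)) \<partial>lborel)
      \<le> (\<integral>\<^sup>+ (x::'a). ennreal (P.M (norm x) powr p) \<partial>lborel)"
  proof (rule nn_integral_mono_AE)
    show "AE x :: 'a in lborel. max (SUP y \<in> cball 0 (norm x) - {0}. ennreal (\<bar>u y\<bar> powr p / norm x powr p))
        (SUP y \<in> - ball 0 (norm x). ennreal (\<bar>u y\<bar> powr p / norm y powr p))
        \<le> ennreal (P.M (norm x) powr p)"
      using nz
    proof eventually_elim
      case (elim x)
      then show ?case by (intro max.boundedI SUP_least quot) auto
    qed
  qed
  also have "\<dots> = k * (\<integral>\<^sup>+r. ennreal (r ^ n) * indicator {0<..} r * ennreal (P.M r powr p) \<partial>lborel)"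
    by (rule polar) simp
  also have "\<dots> \<le> k * (ennreal ((p / (p - real (Suc n))) powr p) *
      (\<integral>\<^sup>+r. ennreal (r ^ n) * indicator {0<..} r * ennreal (\<bar>f' r\<bar> powr p) \<partial>lborel))"
    by (rule mult_left_mono[OF P.Hardy_sup[OF np]]) simp
  also have "\<dots> = ennreal ((p / (p - real (Suc n))) powr p) *
      (\<integral>\<^sup>+x. ennreal (\<bar>f' (norm (x::'a))\<bar> powr p) \<partial>lborel)"
    using P.h_measurable by (subst polar) (simp_all add: mult.left_commute)
  also have "(\<integral>\<^sup>+x. ennreal (\<bar>f' (norm (x::'a))\<bar> powr p) \<partial>lborel) =
      (\<integral>\<^sup>+ x. ennreal (\<bar>(x /\<^sub>R norm x) \<bullet> grad u x\<bar> powr p) \<partial>lborel)"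
  proof (rule nn_integral_cong_AE)
    show "AE x :: 'a in lborel. ennreal (\<bar>f' (norm x)\<bar> powr p) =
        ennreal (\<bar>(x /\<^sub>R norm x) \<bullet> grad u x\<bar> powr p)"
      using nz
    proof eventually_elim
      case (elim x)
      let ?v = "x /\<^sub>R norm x"
      \<comment> \<open>By radiality the profile along \<open>e\<close> is also the profile along
        the direction of \<open>x\<close>, so \<open>f' (norm x)\<close> is the derivative of
        \<open>u\<close> at \<open>x\<close> in that direction.\<close>
      have "f = (\<lambda>t. u (t *\<^sub>R ?v))"
        unfolding f_def[abs_def] using elim e by (intro ext rad) (simp add: abs_mult mult.assoc)
      then have "(f has_real_derivative frechet_derivative u (at x) ?v) (at (norm x))"
        using der_ray[of ?v "norm x"] elim by simp
      then have "f' (norm x) = frechet_derivative u (at x) ?v"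
        using f DERIV_unique by blast
      then show ?case by (simp only: inner_grad[OF der])
    qed
  qed
  also have "p / (p - real (Suc n)) = \<bar>p / (real DIM('a) - p)\<bar>"
    using np p by (simp add: n abs_divide del: of_nat_Suc)
  finally show ?thesis .
qed

end
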